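(* If $T$ is a tree of order $n\ge 3$, then $\iota_{\rm g}(T)\le \frac{5}{11}n$.
   Context: For a graph $G$ and $X\subseteq V(G)$, $N_G[X]$ denotes the set of vertices in $X$ or adjacent to a vertex of $X$. The isolation game on a finite graph $G$ is played by two players, Dominator and Staller, who alternately select vertices of $G$. If $X$ is the set of vertices selected so far, a vertex $x$ may be selected (is playable) only if $x$ dominates (i.e., equals or is adjacent to) some vertex belonging to a component of $G - N_G[X]$ with at least two vertices. The game ends when no playable vertex exists. Dominator aims to minimize the total number of selected vertices, Staller aims to maximize it. The game isolation number $\iota_{\rm g}(G)$ is the number of vertices selected when Dominator makes the first move and both play optimally. *)

theory Defs
  imports Complex_Main "Graph_Theory.Graph_Theory"
begin

text \<open>
  Finite simple graphs are the locale \<^locale>\<open>graph\<close>: finite, symmetric, loop-free digraphs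
  without parallel arcs, every undirected edge being represented by its two orientations.
  The library predicate \<^const>\<open>tree\<close> is not the right notion for them, because there the walk
  \<open>u, v, u\<close> along a single edge already counts as a cycle. In a \<^locale>\<open>graph\<close>, the cycles with
  at least three arcs are exactly the (oriented) cycles of the undirected graph.
\<close>

definition undirected_tree :: "('a, 'b) pre_digraph \<Rightarrow> bool" where
  "undirected_tree G \<longleftrightarrow>
     graph G \<and> connected G \<and> \<not> (\<exists>p. pre_digraph.cycle G p \<and> length p \<ge> 3)"

definition closed_nbhd :: "('a, 'b) pre_digraph \<Rightarrow> 'a set \<Rightarrow> 'a set" where
  "closed_nbhd G X = {v \<in> verts G. v \<in> X \<or> (\<exists>x\<in>X. x \<rightarrow>\<^bsub>G\<^esub> v)}"

text \<open>
  For a symmetric digraph \<open>H\<close>, \<^term>\<open>pre_digraph.sccs_verts H\<close> is the set of the vertex sets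
  of the connected components of \<open>H\<close>.
\<close>

definition playable :: "('a, 'b) pre_digraph \<Rightarrow> 'a set \<Rightarrow> 'a set" where
  "playable G X = {x \<in> verts G.
     \<exists>C \<in> pre_digraph.sccs_verts (G \<restriction> (verts G - closed_nbhd G X)).
       card C \<ge> 2 \<and> (\<exists>v\<in>C. v \<in> closed_nbhd G {x})}"

lemma playable_not_selected:
  assumes "x \<in> playable G X"
  shows "x \<in> verts G - X"
proof -
  let ?H = "G \<restriction> (verts G - closed_nbhd G X)"
  from assms obtain C v where C: "C \<in> pre_digraph.sccs_verts ?H"
    and v: "v \<in> C" "v \<in> closed_nbhd G {x}" and x: "x \<in> verts G"
    unfolding playable_def by blast
  from C v(1) have "v \<rightarrow>\<^sup>*\<^bsub>?H\<^esub> v"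
    unfolding pre_digraph.sccs_verts_def by blast
  then have "v \<in> verts ?H" by (rule reachable_in_vertsE)
  then have "v \<notin> closed_nbhd G X" by simp
  with v(2) x show ?thesis unfolding closed_nbhd_def by auto
qed

datatype player = Dominator | Staller

text \<open>
  \<open>moves_left G p X\<close> is the number of vertices still to be selected under optimal play when the
  set \<open>X\<close> has been selected and player \<open>p\<close> is to move. The finiteness test is needed only for
  totality of the function.
\<close>

function moves_left :: "('a, 'b) pre_digraph \<Rightarrow> player \<Rightarrow> 'a set \<Rightarrow> nat" where
  "moves_left G Dominator X =
     (if finite (verts G) \<and> playable G X \<noteq> {}
      then 1 + Min ((\<lambda>x. moves_left G Staller (insert x X)) ` playable G X) else 0)"
| "moves_left G Staller X =
     (if finite (verts G) \<and> playable G X \<noteq> {}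
      then 1 + Max ((\<lambda>x. moves_left G Dominator (insert x X)) ` playable G X) else 0)"
  by pat_completeness auto
termination
proof (relation "measure (\<lambda>(G, p, X). card (verts G - X))", goal_cases)
  case 1
  show ?case by simp
next
  case (2 G X x)
  then have "x \<in> verts G - X" by (blast dest: playable_not_selected)
  then have "verts G - insert x X \<subset> verts G - X" by blast
  with 2 show ?case by (simp add: psubset_card_mono del: Diff_insert)
next
  case (3 G X x)
  then have "x \<in> verts G - X" by (blast dest: playable_not_selected)
  then have "verts G - insert x X \<subset> verts G - X" by blast
  with 3 show ?case by (simp add: psubset_card_mono del: Diff_insert)
qed

declare moves_left.simps [simp del]

definition game_isolation_number :: "('a, 'b) pre_digraph \<Rightarrow> nat" where
  "game_isolation_number G = moves_left G Dominator {}"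

end

theory Submission
  imports Defs
begin

text \<open>
  Call an undominated vertex with an undominated neighbour white; the position of the game is
  determined by the set of white vertices. Give weight 5 to a white vertex, 4 to a white vertex
  whose white component has just two vertices, 3 to a vertex that is not white but has a white
  neighbour, and 0 to every other vertex. No weight ever increases, so it suffices that Dominator
  can always move so that the total weight drops by at least 11, and by at least 22 together with
  any reply of Staller; the total is at most \<open>5 n\<close> at the beginning.

  Every move costs at least 5. If some white component has more than three vertices, Dominator gains
  17 near the end of a longest path or at the centre of a star. Otherwise all white components are
  paths on two or three vertices. If a path on three vertices remains, playing its centre gains 15,
  and now every move of Staller costs at least 7. If all components have two vertices, either some
  dominated vertex is adjacent to two of them and playing it gains 19, or each component has a
  dominated neighbour of its own (as the tree is connected and \<open>n \<ge> 3\<close>), and every move costs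
  at least 11.
\<close>

section \<open>The game on an acyclic graph in terms of white vertices and weights\<close>

text \<open>\<open>acyc\<close> speaks of vertex lists rather than arc walks, so that a cycle can be
  exhibited by listing its vertices. \<open>edge_ext\<close> is what is kept of connectedness and
  order at least 3: no component of the graph is a single edge.\<close>

locale acyclic_simple_graph =
  fixes V :: "'a set" and adj :: "'a \<Rightarrow> 'a \<Rightarrow> bool"
  assumes fin: "finite V"
    and adj_V: "adj u v \<Longrightarrow> u \<in> V"
    and adj_sym: "adj u v \<Longrightarrow> adj v u"
    and adj_irrefl: "\<not> adj v v"
    and acyc: "\<lbrakk>distinct xs; successively adj xs; length xs \<ge> 3\<rbrakk> \<Longrightarrow> \<not> adj (last xs) (hd xs)"
    and edge_ext: "adj u v \<Longrightarrow> \<exists>z. z \<noteq> u \<and> z \<noteq> v \<and> (adj z u \<or> adj z v)"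
begin

definition nb :: "'a set \<Rightarrow> 'a \<Rightarrow> 'a set" where
  "nb W v = {u \<in> W. adj v u}"

text \<open>The set of white vertices after the move \<open>x\<close>, if it was \<open>W\<close> before.\<close>

definition step :: "'a set \<Rightarrow> 'a \<Rightarrow> 'a set" where
  "step W x = {v \<in> W. v \<noteq> x \<and> \<not> adj x v \<and> (\<exists>u\<in>W. u \<noteq> x \<and> \<not> adj x u \<and> adj v u)}"

definition legal :: "'a set \<Rightarrow> 'a \<Rightarrow> bool" where
  "legal W x \<longleftrightarrow> x \<in> V \<and> (x \<in> W \<or> nb W x \<noteq> {})"

text \<open>White sets have this shape because an undominated neighbour of a white vertex is itself
  white.\<close>

definition position :: "'a set \<Rightarrow> bool" where
  "position W \<longleftrightarrow> W \<subseteq> V \<and> (\<forall>v\<in>W. nb W v \<noteq> {})"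

text \<open>The union of the white components that are single edges; mutual unique neighbours
  express this without forming components.\<close>

definition K2 :: "'a set \<Rightarrow> 'a set" where
  "K2 W = {v \<in> W. \<exists>u\<in>W. nb W v = {u} \<and> nb W u = {v}}"

definition wt :: "'a set \<Rightarrow> 'a \<Rightarrow> nat" where
  "wt W v = (if v \<in> W then (if v \<in> K2 W then 4 else 5) else if nb W v \<noteq> {} then 3 else 0)"

definition \<Phi> :: "'a set \<Rightarrow> nat" where
  "\<Phi> W = (\<Sum>v\<in>V. wt W v)"

lemma adj_commute: "adj u v \<longleftrightarrow> adj v u"
  using adj_sym by blast

lemma in_nb [simp]: "u \<in> nb W v \<longleftrightarrow> u \<in> W \<and> adj v u"
  by (simp add: nb_def)

lemma nb_mono: "W' \<subseteq> W \<Longrightarrow> nb W' v \<subseteq> nb W v"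
  by auto

lemma step_subset: "step W x \<subseteq> W"
  by (auto simp: step_def)

lemma position_step: "position W \<Longrightarrow> position (step W x)"
  unfolding position_def
proof (intro conjI ballI)
  assume W: "W \<subseteq> V \<and> (\<forall>v\<in>W. nb W v \<noteq> {})"
  show "step W x \<subseteq> V" using W step_subset by blast
  fix v assume v: "v \<in> step W x"
  then obtain u where u: "u \<in> W" "u \<noteq> x" "\<not> adj x u" "adj v u" by (auto simp: step_def)
  with v have "u \<in> step W x" by (auto simp: step_def adj_commute)
  with u show "nb (step W x) v \<noteq> {}" by auto
qed

lemma nb_singletonI: "\<lbrakk>b \<in> W; adj a b; \<And>z. \<lbrakk>z \<in> W; adj a z\<rbrakk> \<Longrightarrow> z = b\<rbrakk> \<Longrightarrow> nb W a = {b}"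
  unfolding nb_def by blast

lemma position_nb: "position W \<Longrightarrow> v \<in> W \<Longrightarrow> \<exists>u\<in>W. adj v u"
  unfolding position_def using in_nb by blast

lemma K2_I: "\<lbrakk>v \<in> W; u \<in> W; nb W v = {u}; nb W u = {v}\<rbrakk> \<Longrightarrow> v \<in> K2 W"
  by (auto simp: K2_def)

lemma K2_E:
  assumes "v \<in> K2 W"
  obtains u where "u \<in> K2 W" "nb W v = {u}" "nb W u = {v}" "v \<in> W" "u \<in> W" "adj v u" "u \<noteq> v"
proof -
  from assms obtain u where u: "v \<in> W" "u \<in> W" "nb W v = {u}" "nb W u = {v}"
    by (auto simp: K2_def)
  have "adj v u" using u(3) in_nb[of u W v] by simp
  moreover have "u \<in> K2 W" using u by (auto simp: K2_def)
  ultimately show ?thesis using that u adj_irrefl by metis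
qed

text \<open>A vertex that stays white needs a white neighbour, and its old partner is the only
  candidate. Hence a weight 4 never rises to 5.\<close>

lemma K2_inherit:
  assumes "W' \<subseteq> W" "position W'" "v \<in> K2 W" "v \<in> W'"
  shows "v \<in> K2 W'"
proof -
  from assms(3) obtain u where u: "nb W v = {u}" "nb W u = {v}" by (rule K2_E)
  have n: "nb W' v \<subseteq> {u}" using nb_mono[OF assms(1)] u by blast
  then have v: "nb W' v = {u}" using assms(2,4) by (auto simp: position_def)
  then have "u \<in> W'" using in_nb[of u W' v] by simp
  moreover have "nb W' u = {v}"
    using nb_mono[OF assms(1), of u] u assms(2) \<open>u \<in> W'\<close> by (auto simp: position_def)
  ultimately show ?thesis using v assms(4) by (intro K2_I)
qed

lemma wt_mono:
  assumes "W' \<subseteq> W" "position W'"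
  shows "wt W' v \<le> wt W v"
  using K2_inherit[OF assms, of v] assms(1) nb_mono[OF assms(1), of v] by (auto simp: wt_def)

section \<open>The cost of a move in an arbitrary position\<close>

lemma wt_le_3: "v \<notin> W \<Longrightarrow> wt W v \<le> 3"
  by (simp add: wt_def)

lemma wt_eq_0: "v \<notin> W \<Longrightarrow> nb W v = {} \<Longrightarrow> wt W v = 0"
  by (simp add: wt_def)

text \<open>Weights outside \<open>S\<close> do not rise, so it is enough to account for a few
  vertices near the move. The additive form avoids subtraction on naturals.\<close>

lemma \<Phi>_drop:
  assumes "position W" "S \<subseteq> V"
  shows "\<Phi> (step W x) + (\<Sum>v\<in>S. wt W v) \<le> \<Phi> W + (\<Sum>v\<in>S. wt (step W x) v)"
proof -
  have "(\<Sum>v\<in>V - S. wt (step W x) v) \<le> (\<Sum>v\<in>V - S. wt W v)"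
    by (intro sum_mono wt_mono step_subset position_step assms)
  then show ?thesis
    unfolding \<Phi>_def using sum.subset_diff[OF assms(2) fin, of "wt W"]
      sum.subset_diff[OF assms(2) fin, of "wt (step W x)"] by simp
qed

lemma wt_step_self: "wt (step W x) x = 0"
  by (rule wt_eq_0) (auto simp: step_def)

lemma wt_step_nb: "adj x v \<Longrightarrow> wt (step W x) v \<le> 3"
  by (rule wt_le_3) (auto simp: step_def)

text \<open>Once all white neighbours of \<open>v\<close> are dominated, \<open>v\<close> is neither
  white nor next to a white vertex, even if it is still undominated itself.\<close>

lemma wt_step_isolated:
  assumes "v \<in> W" "\<And>u. u \<in> W \<Longrightarrow> adj v u \<Longrightarrow> u = x \<or> adj x u"
  shows "wt (step W x) v = 0"
  by (rule wt_eq_0; unfold step_def nb_def; use assms in blast)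

lemma wt_step_leaf:
  assumes "v \<in> W" "nb W v = {u}" "u = x \<or> adj x u"
  shows "wt (step W x) v = 0"
proof (rule wt_step_isolated[OF assms(1)])
  fix t assume "t \<in> W" "adj v t"
  then have "t \<in> nb W v" by simp
  then show "t = x \<or> adj x t" using assms(2,3) by (simp del: in_nb)
qed

lemma wt_step_blue:
  assumes "\<And>u. u \<in> W \<Longrightarrow> adj v u \<Longrightarrow> u \<notin> step W x" "v \<notin> step W x"
  shows "wt (step W x) v = 0"
  by (rule wt_eq_0, unfold nb_def) (use assms step_subset[of W x] in blast)+

lemma K2_closed: "\<lbrakk>v \<in> K2 W; u \<in> W; adj v u\<rbrakk> \<Longrightarrow> u \<in> K2 W"
  by (metis K2_E in_nb singletonD)

text \<open>Dominating one end of a white edge takes the only white neighbour from the other end, so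
  both ends drop out.\<close>

lemma K2_hit:
  assumes "position W" "v \<in> W" "u \<in> W" "nb W v = {u}" "nb W u = {v}" "x = v \<or> adj x v"
  shows "v \<notin> step W x" "u \<notin> step W x" "wt (step W x) v = 0" "wt (step W x) u = 0"
proof -
  show v: "v \<notin> step W x" using assms(6) by (auto simp: step_def)
  show u: "u \<notin> step W x"
  proof
    assume "u \<in> step W x"
    then obtain t where "t \<in> W" "t \<noteq> x" "\<not> adj x t" "adj u t" by (auto simp: step_def)
    then have "t \<in> nb W u" by simp
    then show False using \<open>t \<noteq> x\<close> \<open>\<not> adj x t\<close> assms(5,6) by auto
  qed
  have "nb (step W x) v \<subseteq> {u}" "nb (step W x) u \<subseteq> {v}"
    using nb_mono[OF step_subset] assms(4,5) by blast+
  moreover have "nb (step W x) t \<subseteq> step W x" for t by auto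
  ultimately have "nb (step W x) v = {}" "nb (step W x) u = {}" using u v by blast+
  then show "wt (step W x) v = 0" "wt (step W x) u = 0" using u v by (auto intro: wt_eq_0)
qed

lemma drop_K2:
  assumes W: "position W" and v: "v \<in> K2 W" "x = v \<or> adj x v"
  shows "\<Phi> (step W x) + 8 \<le> \<Phi> W"
proof -
  obtain u where u: "u \<in> K2 W" "nb W v = {u}" "nb W u = {v}" "v \<in> W" "u \<in> W" "adj v u" "u \<noteq> v"
    using v(1) by (rule K2_E)
  have "{u, v} \<subseteq> V" using u W by (auto simp: position_def)
  from \<Phi>_drop[OF W this, of x] K2_hit[OF W u(4,5,2,3) v(2)] u v(1)
  show ?thesis by (simp add: wt_def)
qed

text \<open>On a white edge 8 is gained. Elsewhere \<open>x\<close> falls from 5 to 0 and a white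
  neighbour, also outside \<open>K2 W\<close>, from 5 to at most 3.\<close>

lemma drop_white:
  assumes W: "position W" and x: "x \<in> W"
  shows "\<Phi> (step W x) + 7 \<le> \<Phi> W"
proof (cases "x \<in> K2 W")
  case True
  then show ?thesis using drop_K2[OF W True, of x] by simp
next
  case False
  obtain w where w: "w \<in> W" "adj x w" using position_nb[OF W x] by blast
  have "w \<notin> K2 W" using K2_closed[OF _ x adj_sym[OF w(2)]] False by blast
  then have "wt W w = 5" "wt W x = 5" using False x w by (auto simp: wt_def)
  moreover have "{w, x} \<subseteq> V" using x w W by (auto simp: position_def)
  moreover have "w \<noteq> x" using w adj_irrefl by blast
  ultimately show ?thesis
    using \<Phi>_drop[OF W, of "{w, x}" x] wt_step_self[of W x] wt_step_nb[OF w(2), of W] by simp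
qed

text \<open>The worst case is a non-white \<open>x\<close> next to a white vertex of weight 5:
  \<open>x\<close> loses 3 and the neighbour at least 2.\<close>

lemma drop_5:
  assumes W: "position W" and x: "legal W x"
  shows "\<Phi> (step W x) + 5 \<le> \<Phi> W"
proof (cases "x \<in> W")
  case True
  then show ?thesis using drop_white[OF W True] by simp
next
  case False
  then obtain w where w: "w \<in> W" "adj x w" using x by (auto simp: legal_def)
  show ?thesis
  proof (cases "w \<in> K2 W")
    case True
    then show ?thesis using drop_K2[OF W True] w by fastforce
  next
    case wK: False
    have "w \<in> nb W x" using w by simp
    then have "wt W w = 5" "wt W x = 3" using False wK w by (auto simp: wt_def)
    moreover have "{w, x} \<subseteq> V" using x w W by (auto simp: position_def legal_def)
    moreover have "w \<noteq> x" using w adj_irrefl by blast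
    ultimately show ?thesis
      using \<Phi>_drop[OF W, of "{w, x}" x] wt_step_self[of W x] wt_step_nb[OF w(2), of W] by simp
  qed
qed

section \<open>Positions whose components are paths on two or three vertices\<close>

text \<open>
  In an acyclic graph without isolated vertices this says that all components are paths on two or
  three vertices; in this form it is inherited by subsets.
\<close>

definition small :: "'a set \<Rightarrow> bool" where
  "small W \<longleftrightarrow>
    (\<forall>p\<in>W. \<forall>q\<in>W. \<forall>r\<in>W. \<forall>s\<in>W. adj p q \<and> adj q r \<and> adj r s \<longrightarrow> \<not> distinct [p, q, r, s]) \<and>
    (\<forall>v\<in>W. \<forall>p\<in>W. \<forall>q\<in>W. \<forall>r\<in>W. adj v p \<and> adj v q \<and> adj v r \<longrightarrow> \<not> distinct [p, q, r])"

lemma small_subset: "small W \<Longrightarrow> W' \<subseteq> W \<Longrightarrow> small W'"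
  unfolding small_def by (meson subsetD)

lemma small_P4: "\<lbrakk>small W; p \<in> W; q \<in> W; r \<in> W; s \<in> W; adj p q; adj q r; adj r s\<rbrakk>
    \<Longrightarrow> \<not> distinct [p, q, r, s]"
  unfolding small_def by blast

lemma small_deg: "\<lbrakk>small W; v \<in> W; p \<in> W; q \<in> W; r \<in> W; adj v p; adj v q; adj v r\<rbrakk>
    \<Longrightarrow> \<not> distinct [p, q, r]"
  unfolding small_def by blast

lemma no_triangle: "\<lbrakk>adj a b; adj b c\<rbrakk> \<Longrightarrow> \<not> adj c a"
  using acyc[of "[a, b, c]"] adj_irrefl by auto

text \<open>A white component that is a path on three vertices with centre \<open>b\<close>;
  membership outside \<open>K2 W\<close> is recorded because it yields the weight 5.\<close>

definition P3 :: "'a set \<Rightarrow> 'a \<Rightarrow> 'a \<Rightarrow> 'a \<Rightarrow> bool" where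
  "P3 W a b c \<longleftrightarrow> distinct [a, b, c] \<and> {a, b, c} \<subseteq> W - K2 W \<and>
     nb W a = {b} \<and> nb W b = {a, c} \<and> nb W c = {b}"

lemma P3_sym: "P3 W a b c \<Longrightarrow> P3 W c b a"
  by (auto simp: P3_def)

text \<open>The degree bound in \<open>small\<close> leaves the centre only \<open>a\<close> and
  \<open>c\<close>. A further neighbour \<open>z\<close> of an end would start a path
  \<open>z, a, v, c\<close> on four vertices.\<close>

lemma P3_I:
  assumes W: "position W" "small W" and v: "v \<in> W" "a \<in> W" "c \<in> W" "adj v a" "adj v c" "a \<noteq> c"
  shows "P3 W a v c"
proof -
  have va: "v \<noteq> a" "v \<noteq> c" using v adj_irrefl by blast+
  have "r = a \<or> r = c" if "r \<in> W" "adj v r" for r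
    using small_deg[OF W(2) v(1,2,3) that(1) v(4,5) that(2)] v(6) by auto
  then have nv: "nb W v = {a, c}" using v unfolding nb_def by blast
  have leaf: "nb W a = {v}" if "a \<in> W" "c \<in> W" "adj v a" "adj v c" "a \<noteq> c" for a c
  proof -
    have False if z: "z \<in> W" "adj a z" "z \<noteq> v" for z
    proof -
      have av: "adj a v" "adj z a" using adj_sym[OF \<open>adj v a\<close>] adj_sym[OF z(2)] by blast+
      \<comment> \<open>Otherwise \<open>v, a, c\<close> would be a triangle.\<close>
      have "z \<noteq> c" using no_triangle[OF \<open>adj v a\<close> z(2)] adj_sym[OF \<open>adj v c\<close>] by blast
      moreover have "z \<noteq> a" "v \<noteq> a" "v \<noteq> c"
        using z(2) \<open>adj v a\<close> \<open>adj v c\<close> adj_irrefl by blast+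
      ultimately have "distinct [z, a, v, c]" using z(3) \<open>a \<noteq> c\<close> by simp
      then show False
        using small_P4[OF W(2) z(1) \<open>a \<in> W\<close> v(1) \<open>c \<in> W\<close> av(2,1) \<open>adj v c\<close>] by blast
    qed
    then show ?thesis by (intro nb_singletonI v(1) adj_sym[OF \<open>adj v a\<close>]) blast
  qed
  have na: "nb W a = {v}" using leaf v by blast
  have nc: "nb W c = {v}" using leaf[of c a] v by blast
  have vK: "v \<notin> K2 W"
  proof
    assume "v \<in> K2 W"
    then obtain u where "nb W v = {u}" by (rule K2_E)
    then show False using nv v(6) by (simp add: doubleton_eq_iff)
  qed
  then have "a \<notin> K2 W" "c \<notin> K2 W" using K2_closed[OF _ v(1) adj_sym[OF v(4)]] K2_closed[OF _ v(1) adj_sym[OF v(5)]] by blast+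
  then show ?thesis unfolding P3_def using v va na nc nv vK by auto
qed

text \<open>Either \<open>v\<close> has two white neighbours and is the centre, or its only white
  neighbour has another one and is the centre.\<close>

lemma ex_P3:
  assumes W: "position W" "small W" and v: "v \<in> W - K2 W"
  shows "\<exists>a b c. P3 W a b c \<and> v \<in> {a, b, c}"
proof -
  obtain u where u: "u \<in> W" "adj v u" using v position_nb[OF W(1)] by blast
  show ?thesis
  proof (cases "nb W v = {u}")
    case False
    then obtain w where "w \<in> W" "adj v w" "w \<noteq> u" using nb_singletonI[OF u] by blast
    then show ?thesis using P3_I[OF W, of v u w] u v by blast
  next
    case True
    have "nb W u \<noteq> {v}" using True u v K2_I by blast
    then obtain w where "w \<in> W" "adj u w" "w \<noteq> v"
      using nb_singletonI[OF _ adj_sym[OF u(2)]] v by blast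
    then show ?thesis using P3_I[OF W, of u v w] u v adj_sym[OF u(2)] by blast
  qed
qed

lemma drop_7:
  assumes W: "position W" "small W" and x: "legal W x"
  shows "\<Phi> (step W x) + 7 \<le> \<Phi> W"
proof (cases "x \<in> W")
  case True
  then show ?thesis using drop_white[OF W(1) True] by simp
next
  case xW: False
  then obtain w where w: "w \<in> W" "adj x w" using x by (auto simp: legal_def)
  have xV: "x \<in> V" using x by (simp add: legal_def)
  have WV: "W \<subseteq> V" using W by (simp add: position_def)
  have "w \<in> nb W x" using w by simp
  then have wx: "wt W x = 3" using xW by (auto simp: wt_def)
  \<comment> \<open>A non-white \<open>x\<close> next to an end of the path gains 3 at
    \<open>x\<close>, at least 2 at \<open>a\<close>, and at least 1 at each of \<open>b\<close> and
    \<open>c\<close>, because what is left is at most a single edge.\<close>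
  have leaf_hit: ?thesis if P: "P3 W a b c" and xa: "adj x a" for a b c
  proof -
    let ?S = "step W x"
    have "position ?S" using W(1) by (rule position_step)
    have aS: "a \<notin> ?S" using xa by (auto simp: step_def)
    have "nb ?S b \<subseteq> {a, c}" "a \<notin> nb ?S b"
      using nb_mono[OF step_subset, of W x b] P aS by (simp_all add: P3_def)
    then have sub: "nb ?S b \<subseteq> {c}" by blast
    have sub': "nb ?S c \<subseteq> {b}"
      using nb_mono[OF step_subset, of W x c] P by (simp add: P3_def)
    \<comment> \<open>With \<open>a\<close> dominated, \<open>b\<close> and \<open>c\<close> are
      each other's only possible white neighbour, so if one stays white, both do.\<close>
    have bc: "b \<in> K2 ?S \<and> c \<in> K2 ?S" if t: "t \<in> ?S" "t = b \<or> t = c" for t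
    proof -
      have nonempty: "nb ?S v \<noteq> {}" if "v \<in> ?S" for v
        using \<open>position ?S\<close> that by (simp add: position_def)
      have "nb ?S v \<subseteq> ?S" for v by auto
      then have S: "b \<in> ?S" "c \<in> ?S" using t nonempty sub sub' by blast+
      then have "nb ?S b = {c}" "nb ?S c = {b}" using nonempty sub sub' by blast+
      then show ?thesis using K2_I[OF S] K2_I[OF S(2,1)] by simp
    qed
    then have K: "b \<in> K2 ?S" "c \<in> K2 ?S" if "b \<in> ?S \<or> c \<in> ?S" using that by auto
    have "wt ?S b \<le> 4" "wt ?S c \<le> 4" using K by (auto simp: wt_def)
    moreover have "wt W a = 5" "wt W b = 5" "wt W c = 5" using P by (auto simp: P3_def wt_def)
    moreover have "distinct [x, a, b, c]" "{x, a, b, c} \<subseteq> V"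
      using P xW xV WV by (auto simp: P3_def)
    ultimately show ?thesis
      using \<Phi>_drop[OF W(1), of "{x, a, b, c}" x] wt_step_self[of W x] wt_step_nb[OF xa, of W] wx
      by simp
  qed
  show ?thesis
  proof (cases "w \<in> K2 W")
    case True
    then show ?thesis using drop_K2[OF W(1) True] w by fastforce
  next
    case False
    then obtain a b c where P: "P3 W a b c" "w \<in> {a, b, c}" using ex_P3[OF W] w by blast
    consider "w = a" | "w = b" | "w = c" using P(2) by blast
    then show ?thesis
    proof cases
      case 1
      then show ?thesis using leaf_hit P w by blast
    next
      case 3
      then show ?thesis using leaf_hit[OF P3_sym[OF P(1)]] w by blast
    next
      \<comment> \<open>Dominating the centre cuts off the end \<open>a\<close>, which loses 5,
        while the centre loses at least 2.\<close>
      case 2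
      have a: "a \<in> W" "nb W a = {b}" using P(1) by (simp_all add: P3_def)
      then have "u = b" if "u \<in> W" "adj a u" for u using in_nb[of u W a] that by simp
      then have "wt (step W x) a = 0" using w 2 by (intro wt_step_isolated a(1)) blast
      moreover have "wt W a = 5" "wt W b = 5" using P by (auto simp: P3_def wt_def)
      moreover have "a \<noteq> b" "{a, b} \<subseteq> V"
        using P WV by (auto simp: P3_def)
      ultimately show ?thesis
        using \<Phi>_drop[OF W(1), of "{a, b}" x] wt_step_nb[of x b W] w 2 by simp
    qed
  qed
qed

section \<open>White edges without common neighbours\<close>

text \<open>All white components are single edges, and no non-white vertex sees two of them: two
  distinct white neighbours would have to be partners.\<close>

definition exclusive :: "'a set \<Rightarrow> bool" where
  "exclusive W \<longleftrightarrow> W \<subseteq> K2 W \<and> (\<forall>y. y \<notin> W \<longrightarrow> (\<forall>u\<in>nb W y. \<forall>v\<in>nb W y. u = v \<or> nb W u = {v}))"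

lemma exclusiveD:
  assumes "exclusive W"
  shows "W \<subseteq> K2 W" "\<lbrakk>y \<notin> W; u \<in> nb W y; v \<in> nb W y\<rbrakk> \<Longrightarrow> u = v \<or> nb W u = {v}"
proof -
  show "W \<subseteq> K2 W" using assms unfolding exclusive_def by (rule conjunct1)
  have "\<forall>y. y \<notin> W \<longrightarrow> (\<forall>u\<in>nb W y. \<forall>v\<in>nb W y. u = v \<or> nb W u = {v})"
    using assms unfolding exclusive_def by (rule conjunct2)
  then show "\<lbrakk>y \<notin> W; u \<in> nb W y; v \<in> nb W y\<rbrakk> \<Longrightarrow> u = v \<or> nb W u = {v}" by blast
qed

lemma exclusive_step:
  assumes W: "position W" "exclusive W"
  shows "exclusive (step W x)"
  unfolding exclusive_def
proof (intro conjI allI impI ballI)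
  let ?S = "step W x"
  have S: "?S \<subseteq> W" "position ?S" by (rule step_subset) (rule position_step[OF W(1)])
  have "W \<subseteq> K2 W" using exclusiveD(1)[OF W(2)] .
  then show "?S \<subseteq> K2 ?S" using K2_inherit[OF S] S(1) by (meson subset_iff)
  fix y u v assume y: "y \<notin> ?S" and u: "u \<in> nb ?S y" and v: "v \<in> nb ?S y"
  have uv: "u \<in> nb W y" "v \<in> nb W y" using u v subsetD[OF S(1)] by simp_all
  show "u = v \<or> nb ?S u = {v}"
  proof (cases "y \<in> W")
    \<comment> \<open>The vertex \<open>y\<close> has just ceased to be white; it had only its
      partner as a white neighbour.\<close>
    case True
    moreover have "W \<subseteq> K2 W" using exclusiveD(1)[OF W(2)] .
    ultimately have "y \<in> K2 W" by blast
    then obtain t where "nb W y = {t}" by (rule K2_E)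
    then show ?thesis using uv by (simp del: in_nb)
  next
    case False
    have "nb ?S u \<noteq> {}" using S(2) u by (simp add: position_def)
    then have "nb ?S u = {v}" if "nb W u = {v}"
      using nb_mono[OF S(1), of u] unfolding that by (simp add: subset_singleton_iff)
    then show ?thesis using exclusiveD(2)[OF W(2) False uv] by blast
  qed
qed

text \<open>Besides the 8 from the white edge, the neighbour \<open>z\<close> given by
  \<open>edge_ext\<close> loses 3: by exclusivity it sees no white vertex outside this edge.\<close>

lemma drop_11:
  assumes W: "position W" "exclusive W" and x: "legal W x"
  shows "\<Phi> (step W x) + 11 \<le> \<Phi> W"
proof -
  let ?S = "step W x"
  obtain v where v: "v \<in> W" "x = v \<or> adj x v"
    using x unfolding legal_def nb_def by blast
  have "W \<subseteq> K2 W" using exclusiveD(1)[OF W(2)] .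
  then have "v \<in> K2 W" using v(1) by blast
  then obtain u where u: "u \<in> K2 W" "nb W v = {u}" "nb W u = {v}" "v \<in> W" "u \<in> W" "adj v u" "u \<noteq> v"
    by (rule K2_E)
  note hit = K2_hit[OF W(1) u(4,5,2,3) v(2)]
  obtain z where z: "z \<noteq> v" "z \<noteq> u" "adj z v \<or> adj z u" using edge_ext[OF u(6)] by blast
  have zW: "z \<notin> W"
  proof
    assume "z \<in> W"
    then have "z \<in> nb W v \<or> z \<in> nb W u" using z(3) adj_commute[of z] by simp
    then show False using u(2,3) z(1,2) by (simp del: in_nb)
  qed
  have "nb W z \<subseteq> {u, v}"
  proof
    fix t assume t: "t \<in> nb W z"
    have ex: "p = q \<or> nb W p = {q}" if "p \<in> nb W z" "q \<in> nb W z" for p q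
      using exclusiveD(2)[OF W(2) zW that] .
    have "v \<in> nb W z \<or> u \<in> nb W z" using z u(4,5) by simp
    then show "t \<in> {u, v}" using ex[OF _ t, of v] ex[OF _ t, of u] unfolding u(2,3) by blast
  qed
  then have "nb ?S z = {}" using hit(1,2) step_subset[of W x] unfolding nb_def by blast
  then have "wt ?S z = 0" using zW step_subset[of W x] by (auto intro: wt_eq_0)
  moreover have "nb W z \<noteq> {}" using z(3) u(4,5) unfolding nb_def by blast
  then have "wt W z = 3" using zW by (simp add: wt_def)
  moreover have "wt W u = 4" "wt W v = 4" using u \<open>v \<in> K2 W\<close> by (simp_all add: wt_def)
  moreover have "{u, v, z} \<subseteq> V" using u z W(1) adj_V by (auto simp: position_def)
  ultimately show ?thesis using \<Phi>_drop[OF W(1), of "{u, v, z}" x] hit u(7) z by simp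
qed

section \<open>Large components: longest paths and stars\<close>

text \<open>A chord from \<open>a\<close> to \<open>c\<close> would close the initial segment ending
  in \<open>c\<close> to a cycle; the vertex \<open>b\<close> in between makes its length at least
  3.\<close>

lemma no_chord:
  assumes "distinct (a # b # r)" "successively adj (a # b # r)" "c \<in> set r"
  shows "\<not> adj a c"
proof -
  obtain r1 r2 where r: "r = r1 @ c # r2" using assms(3) split_list by metis
  let ?xs = "a # b # r1 @ [c]"
  have eq: "a # b # r = ?xs @ r2" using r by simp
  have "distinct ?xs" "successively adj ?xs"
    using assms(1,2) unfolding eq by (simp_all only: distinct_append successively_append_iff)
  then have "\<not> adj (last ?xs) (hd ?xs)" by (intro acyc) auto
  then show ?thesis using adj_sym by auto
qed

definition path :: "'a set \<Rightarrow> 'a list \<Rightarrow> bool" where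
  "path W xs \<longleftrightarrow> distinct xs \<and> successively adj xs \<and> set xs \<subseteq> W"

definition longest_path :: "'a set \<Rightarrow> 'a list \<Rightarrow> bool" where
  "longest_path W xs \<longleftrightarrow> path W xs \<and> (\<forall>ys. path W ys \<longrightarrow> length ys \<le> length xs)"

text \<open>Another white neighbour of the end would be a chord if it lay on the path and would
  prolong the path otherwise.\<close>

lemma longest_path_end:
  assumes "longest_path W (a # b # r)"
  shows "nb W a = {b}"
proof -
  have p: "distinct (a # b # r)" "successively adj (a # b # r)" "set (a # b # r) \<subseteq> W"
    using assms by (auto simp: longest_path_def path_def)
  have "u = b" if u: "u \<in> W" "adj a u" for u
  proof (cases "u \<in> set (a # b # r)")
    case True
    then show ?thesis using no_chord[OF p(1,2)] u adj_irrefl by auto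
  next
    case False
    then have "path W (u # a # b # r)" using False p u adj_sym[OF u(2)] by (simp add: path_def)
    then have "length (u # a # b # r) \<le> length (a # b # r)"
      using assms unfolding longest_path_def by blast
    then show ?thesis by simp
  qed
  moreover have "b \<in> W" "adj a b" using p by simp_all
  ultimately show ?thesis by (intro nb_singletonI)
qed

text \<open>Let a longest path start with \<open>a, b, c, d\<close>. If \<open>b\<close> has a
  further neighbour \<open>y\<close>, playing \<open>b\<close> removes \<open>a\<close>,
  \<open>y\<close> and \<open>b\<close> and dominates \<open>c\<close>; otherwise playing
  \<open>c\<close> removes \<open>a\<close>, \<open>b\<close> and \<open>c\<close> and dominates
  \<open>d\<close>. Either way the gain is 5 + 5 + 5 + 2.\<close>

lemma drop_17_path:
  assumes W: "position W" and p0: "path W xs0" "length xs0 \<ge> 4"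
  shows "\<exists>x. legal W x \<and> \<Phi> (step W x) + 17 \<le> \<Phi> W"
proof -
  have WV: "W \<subseteq> V" using W by (simp add: position_def)
  then have finW: "finite W" using fin finite_subset by blast
  have "length ys < Suc (card W)" if "path W ys" for ys
  proof -
    have "card (set ys) \<le> card W" using that finW by (intro card_mono) (auto simp: path_def)
    then show ?thesis using that distinct_card[of ys] by (simp add: path_def)
  qed
  then obtain xs where xs: "path W xs" "\<forall>ys. path W ys \<longrightarrow> length ys \<le> length xs"
    using ex_has_greatest_nat[of "path W" xs0 length "Suc (card W)"] p0(1) by blast
  then have "length xs \<ge> 4" using p0 by fastforce
  then obtain a b c d r where xs_eq: "xs = a # b # c # d # r"
    by (auto simp: numeral_eq_Suc Suc_le_length_iff)
  have l: "longest_path W (a # b # c # d # r)" using xs xs_eq by (simp add: longest_path_def)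
  have p: "distinct (a # b # c # d # r)" "successively adj (a # b # c # d # r)"
    "set (a # b # c # d # r) \<subseteq> W"
    using l by (auto simp: longest_path_def path_def)
  then have ad: "adj a b" "adj b c" "adj c d" by simp_all
  note ad' = ad[THEN adj_sym]
  have inW: "a \<in> W" "b \<in> W" "c \<in> W" "d \<in> W" using p(3) by auto
  have na: "nb W a = {b}" using longest_path_end[OF l] .
  have "b \<notin> K2 W"
  proof
    assume "b \<in> K2 W"
    then obtain u where "nb W b = {u}" by (rule K2_E)
    moreover have "a \<in> nb W b" "c \<in> nb W b" using ad ad' inW by simp_all
    ultimately show False using p(1) by (simp del: in_nb)
  qed
  then have nK: "a \<notin> K2 W" "b \<notin> K2 W" "c \<notin> K2 W" "d \<notin> K2 W"
    using K2_closed[OF _ inW(2) ad(1)] K2_closed[OF _ inW(2) ad'(2)] K2_closed[OF _ inW(3) ad'(3)]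
    by blast+
  have wt5: "wt W a = 5" "wt W b = 5" "wt W c = 5" "wt W d = 5" using nK inW by (auto simp: wt_def)
  show ?thesis
  proof (cases "nb W b \<subseteq> {a, c}")
    case False
    then obtain y where y: "y \<in> W" "adj b y" "y \<noteq> a" "y \<noteq> c" unfolding nb_def by blast
    have p': "distinct (b # c # d # r)" "successively adj (b # c # d # r)" using p by auto
    have "y \<notin> set (d # r)" using no_chord[OF p'] y by blast
    moreover have "y \<noteq> b" using y adj_irrefl by blast
    ultimately have "path W (y # b # c # d # r)"
      using p y adj_sym[OF y(2)] by (simp add: path_def)
    \<comment> \<open>Replacing \<open>a\<close> by \<open>y\<close> keeps the length, so
      \<open>y\<close> is an end of a longest path and hence a leaf too.\<close>
    then have "longest_path W (y # b # c # d # r)" using l by (simp add: longest_path_def)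
    then have ny: "nb W y = {b}" by (rule longest_path_end)
    have "y \<notin> K2 W" using K2_closed[OF _ inW(2) adj_sym[OF y(2)]] nK(2) by blast
    then have "wt W y = 5" using y by (simp add: wt_def)
    moreover have "wt (step W b) a = 0" "wt (step W b) y = 0"
      using wt_step_leaf[OF inW(1) na, of b] wt_step_leaf[OF y(1) ny, of b] by simp_all
    moreover have "{a, y, b, c} \<subseteq> V" "distinct [a, y, b, c]" using WV inW y p \<open>y \<noteq> b\<close> by auto
    ultimately have "\<Phi> (step W b) + 17 \<le> \<Phi> W"
      using \<Phi>_drop[OF W, of "{a, y, b, c}" b] wt_step_self[of W b] wt_step_nb[OF ad(2), of W] wt5
      by simp
    then show ?thesis using inW WV by (auto simp: legal_def)
  next
    case True
    then have "\<And>u. u \<in> W \<Longrightarrow> adj b u \<Longrightarrow> u = a \<or> u = c" by auto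
    \<comment> \<open>Its only white neighbour \<open>b\<close> is dominated by \<open>c\<close>.
      Thus \<open>b\<close> is left with no white neighbour either.\<close>
    moreover have "a \<notin> step W c" 
    proof
      assume "a \<in> step W c"
      then obtain u where u: "u \<in> nb W a" "\<not> adj c u" by (auto simp: step_def)
      then have "u = b" using na by (simp del: in_nb)
      then show False using u ad' by simp
    qed
    ultimately have "wt (step W c) b = 0"
      using ad' by (intro wt_step_blue) (auto simp: step_def)
    moreover have "wt (step W c) a = 0"
      using wt_step_leaf[OF inW(1) na] ad' by blast
    moreover have "{a, b, c, d} \<subseteq> V" "distinct [a, b, c, d]" using WV inW p by auto
    ultimately have "\<Phi> (step W c) + 17 \<le> \<Phi> W"
      using \<Phi>_drop[OF W, of "{a, b, c, d}" c] wt_step_self[of W c] wt_step_nb[OF ad(3), of W] wt5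
      by simp
    then show ?thesis using inW WV by (auto simp: legal_def)
  qed
qed

text \<open>Without paths on four vertices, failure of \<open>small\<close> gives a vertex with
  three white neighbours. These are leaves, and playing the centre even gains 20.\<close>

lemma drop_17:
  assumes W: "position W" and ns: "\<not> small W"
  shows "\<exists>x. legal W x \<and> \<Phi> (step W x) + 17 \<le> \<Phi> W"
proof (cases "\<exists>xs. path W xs \<and> length xs \<ge> 4")
  case True
  then show ?thesis using drop_17_path[OF W] by blast
next
  case False
  have P4: "\<not> distinct [p, q, r, s]"
    if "p \<in> W" "q \<in> W" "r \<in> W" "s \<in> W" "adj p q" "adj q r" "adj r s" for p q r s
  proof
    assume "distinct [p, q, r, s]"
    then have "path W [p, q, r, s]" using that by (simp add: path_def)
    then show False using False by fastforce
  qed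
  then obtain v p q r where v: "v \<in> W" "p \<in> W" "q \<in> W" "r \<in> W"
    "adj v p" "adj v q" "adj v r" "distinct [p, q, r]"
    using ns unfolding small_def by blast
  have leaf: "nb W p = {v}" if pqr: "p \<in> W" "q \<in> W" "r \<in> W"
    "adj v p" "adj v q" "adj v r" "distinct [p, q, r]" for p q r
  proof -
    have False if z: "z \<in> W" "adj p z" "z \<noteq> v" for z
    proof -
      have "z \<noteq> p" "v \<noteq> p" "v \<noteq> q" "v \<noteq> r" using z adj_irrefl \<open>adj v p\<close> \<open>adj v q\<close> \<open>adj v r\<close> by blast+
      \<comment> \<open>The vertex \<open>z\<close> may coincide with one of \<open>q\<close> and
        \<open>r\<close> but not with both; the other one completes a path on four vertices.\<close>
      then have "\<not> distinct [z, p, v, q]" "\<not> distinct [z, p, v, r]"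
        using P4[OF z(1) pqr(1) v(1) pqr(2) adj_sym[OF z(2)] adj_sym[OF pqr(4)] pqr(5)]
          P4[OF z(1) pqr(1) v(1) pqr(3) adj_sym[OF z(2)] adj_sym[OF pqr(4)] pqr(6)] by blast+
      then show False using \<open>z \<noteq> p\<close> \<open>v \<noteq> p\<close> \<open>v \<noteq> q\<close> \<open>v \<noteq> r\<close> z(3) pqr(7) by simp
    qed
    then show ?thesis by (intro nb_singletonI v(1) adj_sym[OF \<open>adj v p\<close>]) blast
  qed
  have n: "nb W p = {v}" "nb W q = {v}" "nb W r = {v}"
    using leaf[of p q r] leaf[of q p r] leaf[of r p q] v by auto
  have "v \<notin> K2 W"
  proof
    assume "v \<in> K2 W"
    then obtain u where "nb W v = {u}" by (rule K2_E)
    moreover have "p \<in> nb W v" "q \<in> nb W v" using v by auto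
    ultimately show False using v(8) by (simp del: in_nb)
  qed
  then have "p \<notin> K2 W" "q \<notin> K2 W" "r \<notin> K2 W" using K2_closed[OF _ v(1)] adj_sym[OF v(5)] adj_sym[OF v(6)] adj_sym[OF v(7)] by blast+
  then have "wt W v = 5" "wt W p = 5" "wt W q = 5" "wt W r = 5"
    using v \<open>v \<notin> K2 W\<close> by (auto simp: wt_def)
  moreover have "wt (step W v) p = 0" "wt (step W v) q = 0" "wt (step W v) r = 0"
    using wt_step_leaf[OF v(2) n(1), of v] wt_step_leaf[OF v(3) n(2), of v]
      wt_step_leaf[OF v(4) n(3), of v] by simp_all
  moreover have "{v, p, q, r} \<subseteq> V" using v W by (auto simp: position_def)
  moreover have "distinct [v, p, q, r]" using v adj_irrefl by auto
  ultimately have "\<Phi> (step W v) + 17 \<le> \<Phi> W"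
    using \<Phi>_drop[OF W, of "{v, p, q, r}" v] wt_step_self[of W v] by simp
  then show ?thesis using v W by (auto simp: legal_def position_def)
qed

text \<open>The last assumption says that \<open>v\<close> is not the partner of \<open>u\<close>,
  so two disjoint white edges vanish (16) together with the weight 3 of \<open>y\<close>.\<close>

lemma drop_19:
  assumes W: "position W" and y: "y \<notin> W" and uv: "u \<in> K2 W" "v \<in> K2 W" "adj y u" "adj y v"
    and ne: "u \<noteq> v" "nb W u \<noteq> {v}"
  shows "legal W y" "\<Phi> (step W y) + 19 \<le> \<Phi> W"
proof -
  obtain u' where u': "u' \<in> K2 W" "nb W u = {u'}" "nb W u' = {u}" "u \<in> W" "u' \<in> W" "adj u u'" "u' \<noteq> u"
    using uv(1) by (rule K2_E)
  obtain v' where v': "v' \<in> K2 W" "nb W v = {v'}" "nb W v' = {v}" "v \<in> W" "v' \<in> W" "adj v v'" "v' \<noteq> v"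
    using uv(2) by (rule K2_E)
  have yV: "y \<in> V" using uv(3) adj_V by blast
  have un: "u \<in> nb W y" using uv u' by simp
  then show "legal W y" using yV by (auto simp: legal_def)
  have "distinct [y, u, u', v, v']" using ne u' v' y by auto
  moreover have "{y, u, u', v, v'} \<subseteq> V" using u' v' yV W by (auto simp: position_def)
  moreover have "wt W y = 3" using un y by (auto simp: wt_def)
  moreover have "wt W u = 4" "wt W u' = 4" "wt W v = 4" "wt W v' = 4"
    using uv u' v' by (auto simp: wt_def)
  ultimately show "\<Phi> (step W y) + 19 \<le> \<Phi> W"
    using \<Phi>_drop[OF W, of "{y, u, u', v, v'}" y] wt_step_self[of W y]
      K2_hit[OF W u'(4,5,2,3), of y] K2_hit[OF W v'(4,5,2,3), of y] uv by simp
qed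

lemma drop_15:
  assumes W: "position W" and P: "P3 W a b c"
  shows "\<Phi> (step W b) + 15 \<le> \<Phi> W"
proof -
  have "wt (step W b) a = 0" "wt (step W b) c = 0"
    using P wt_step_leaf[of a W b b] wt_step_leaf[of c W b b] by (simp_all add: P3_def)
  moreover have "wt W a = 5" "wt W b = 5" "wt W c = 5" using P by (auto simp: P3_def wt_def)
  moreover have "{a, b, c} \<subseteq> V" "distinct [a, b, c]" using P W by (auto simp: P3_def position_def)
  ultimately show ?thesis
    using \<Phi>_drop[OF W, of "{a, b, c}" b] wt_step_self[of W b] by simp
qed

section \<open>Dominator's strategy\<close>

text \<open>The bound 22 arises as 17 + 5, 15 + 7 or 11 + 11, and is exceeded by 19 + 5. The
  separate bound 11 covers a game that ends with Dominator's move.\<close>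

lemma good_move:
  assumes W: "position W" and ne: "W \<noteq> {}"
  shows "\<exists>x. legal W x \<and> \<Phi> (step W x) + 11 \<le> \<Phi> W \<and>
    (\<forall>x'. legal (step W x) x' \<longrightarrow> \<Phi> (step (step W x) x') + 22 \<le> \<Phi> W)"
proof -
  have big: ?thesis if x: "legal W x" "\<Phi> (step W x) + 17 \<le> \<Phi> W" for x
  proof -
    have "\<Phi> (step (step W x) x') + 22 \<le> \<Phi> W" if "legal (step W x) x'" for x'
      using drop_5[OF position_step[OF W] that] x(2) by simp
    then show ?thesis using x by fastforce
  qed
  show ?thesis
  proof (cases "small W")
    case False
    then show ?thesis using drop_17[OF W] big by blast
  next
    case small: True
    show ?thesis
    proof (cases "W \<subseteq> K2 W")
      case False
      then obtain a b c where P: "P3 W a b c" using ex_P3[OF W small] by blast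
      have "\<Phi> (step (step W b) x') + 22 \<le> \<Phi> W" if "legal (step W b) x'" for x'
        using drop_7[OF position_step[OF W] small_subset[OF small step_subset] that]
          drop_15[OF W P] by simp
      moreover have "legal W b" using P W by (auto simp: P3_def legal_def position_def)
      ultimately show ?thesis using drop_15[OF W P] by fastforce
    next
      case WK: True
      show ?thesis
      proof (cases "exclusive W")
        case True
        \<comment> \<open>Every legal move gains 11 here, so any white vertex will do.\<close>
        obtain x where "x \<in> W" using ne by blast
        then have x: "legal W x" using W by (auto simp: legal_def position_def)
        have "\<Phi> (step (step W x) x') + 22 \<le> \<Phi> W" if "legal (step W x) x'" for x'
          using drop_11[OF position_step[OF W] exclusive_step[OF W True] that]
            drop_11[OF W True x] by simp
        then show ?thesis using drop_11[OF W True x] x by blast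
      next
        case False
        then obtain y u v where "y \<notin> W" "u \<in> nb W y" "v \<in> nb W y" "u \<noteq> v" "nb W u \<noteq> {v}"
          using WK unfolding exclusive_def by blast
        then have "legal W y \<and> \<Phi> (step W y) + 19 \<le> \<Phi> W"
          using drop_19[OF W, of y u v] WK by auto
        then show ?thesis using big[of y] by simp
      qed
    qed
  qed
qed

end

section \<open>From trees as digraphs to the acyclic setting\<close>

lemma (in wf_digraph) ex_awalk_of_verts:
  assumes "xs \<noteq> []" "set xs \<subseteq> verts G" "successively (\<lambda>u v. u \<rightarrow>\<^bsub>G\<^esub> v) xs"
  shows "\<exists>p. awalk (hd xs) p (last xs) \<and> awalk_verts (hd xs) p = xs"
  using assms
proof (induction xs)
  case Nil
  then show ?case by simp
next
  case (Cons a xs)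
  show ?case
  proof (cases xs)
    case Nil
    then have "awalk a [] a \<and> awalk_verts a [] = [a]" using Cons.prems by (simp add: awalk_Nil_iff)
    then show ?thesis using Nil by (metis last.simps list.sel(1))
  next
    case (Cons b ys)
    then obtain p where p: "awalk b p (last xs)" "awalk_verts b p = xs"
      using Cons.IH Cons.prems by auto
    have "a \<rightarrow>\<^bsub>G\<^esub> b" using Cons.prems Cons by simp
    then obtain e where e: "e \<in> arcs G" "tail G e = a" "head G e = b" by (rule reachableE)
    have "awalk a (e # p) (last xs)" "awalk_verts a (e # p) = a # xs"
      using p e by (simp_all add: awalk_Cons_iff)
    then show ?thesis using Cons by auto
  qed
qed

text \<open>A closed vertex list lifts to an arc cycle, which a tree excludes. By connectedness, an
  edge with no further neighbour would be the whole tree, contradicting the order.\<close>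

lemma undirected_tree_acyclic_simple_graph:
  assumes T: "undirected_tree T" and card: "card (verts T) \<ge> 3"
  shows "acyclic_simple_graph (verts T) (\<lambda>u v. u \<rightarrow>\<^bsub>T\<^esub> v)"
proof -
  interpret graph T using T by (simp add: undirected_tree_def)
  have sym: "v \<rightarrow>\<^bsub>T\<^esub> u" if "u \<rightarrow>\<^bsub>T\<^esub> v" for u v
    using arcs_ends_symmetric[OF sym_arcs] that by blast
  show ?thesis
  proof
    show "finite (verts T)" by simp
    show "u \<in> verts T" if "u \<rightarrow>\<^bsub>T\<^esub> v" for u v using that adj_in_verts by blast
    show "v \<rightarrow>\<^bsub>T\<^esub> u" if "u \<rightarrow>\<^bsub>T\<^esub> v" for u v using sym that .
    show "\<not> v \<rightarrow>\<^bsub>T\<^esub> v" for v using adj_not_same by blast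
  next
    fix xs assume xs: "distinct xs" "successively (\<lambda>u v. u \<rightarrow>\<^bsub>T\<^esub> v) xs" "length xs \<ge> 3"
    show "\<not> last xs \<rightarrow>\<^bsub>T\<^esub> hd xs"
    proof
      assume e: "last xs \<rightarrow>\<^bsub>T\<^esub> hd xs"
      let ?ys = "xs @ [hd xs]"
      obtain a ys where ys: "xs = a # ys" using xs(3) by (cases xs) auto
      have succ: "successively (\<lambda>u v. u \<rightarrow>\<^bsub>T\<^esub> v) ?ys" using xs(2) e by (simp add: successively_append_iff)
      have sub: "set xs \<subseteq> verts T"
      proof
        fix v assume "v \<in> set xs"
        then obtain l r where lr: "xs = l @ v # r" using split_list by metis
        \<comment> \<open>The closed list provides a successor even for the last vertex.\<close>
        then have "\<exists>w. v \<rightarrow>\<^bsub>T\<^esub> w"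
          using succ by (cases r) (auto simp: successively_append_iff)
        then show "v \<in> verts T" using adj_in_verts by blast
      qed
      then have "set ?ys \<subseteq> verts T" using ys by auto
      then obtain p where p: "awalk (hd ?ys) p (last ?ys)" "awalk_verts (hd ?ys) p = ?ys"
        using ex_awalk_of_verts[of ?ys] succ by auto
      \<comment> \<open>Repeating the first vertex makes the number of arcs equal to
        \<open>length xs\<close>.\<close>
      have "Suc (length p) = length ?ys" using p(2) length_awalk_verts by metis
      then have len: "length p \<ge> 3" using xs(3) by simp
      have "awalk a p a" "distinct (tl (awalk_verts a p))" using p xs(1) ys by auto
      then have "cycle p" unfolding cycle_def using len by auto
      then show False using T len by (auto simp: undirected_tree_def)
    qed
  next
    fix u v assume uv: "u \<rightarrow>\<^bsub>T\<^esub> v"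
    show "\<exists>z. z \<noteq> u \<and> z \<noteq> v \<and> (z \<rightarrow>\<^bsub>T\<^esub> u \<or> z \<rightarrow>\<^bsub>T\<^esub> v)"
    proof (rule ccontr)
      assume c: "\<not> ?thesis"
      \<comment> \<open>The set \<open>{u, v}\<close> is closed under adjacency and therefore
        contains everything reachable from \<open>u\<close>.\<close>
      have "w \<in> {u, v}" if w: "w \<in> verts T" for w
      proof -
        have "u \<rightarrow>\<^sup>*\<^bsub>mk_symmetric T\<^esub> w"
          using T w adj_in_verts(1)[OF uv] by (auto simp: undirected_tree_def connected_def strongly_connected_def)
        then have "u \<rightarrow>\<^sup>*\<^bsub>T\<^esub> w" using reachable_mk_symmetric_eq[OF sym_arcs] by blast
        then show ?thesis
          by (induction rule: reachable_induct) (use c sym in blast)+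
      qed
      then have "verts T \<subseteq> {u, v}" by blast
      then have "card (verts T) \<le> card {u, v}" by (intro card_mono) auto
      also have "\<dots> \<le> 2" by (simp add: card_insert_if)
      finally show False using card by simp
    qed
  qed
qed

section \<open>Playable vertices and white vertices\<close>

definition white :: "('a, 'b) pre_digraph \<Rightarrow> 'a set \<Rightarrow> 'a set" where
  "white G X = {v \<in> verts G - closed_nbhd G X. \<exists>u\<in>verts G - closed_nbhd G X. v \<rightarrow>\<^bsub>G\<^esub> u}"

lemma dominates_induce_iff:
  "u \<rightarrow>\<^bsub>G \<restriction> S\<^esub> v \<longleftrightarrow> u \<in> S \<and> v \<in> S \<and> u \<rightarrow>\<^bsub>G\<^esub> v"
  by (auto simp: arcs_ends_def arc_to_ends_def)

text \<open>The first arc of a walk to another vertex of the component gives an undominated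
  neighbour; conversely such a neighbour lies in the same component by symmetry.\<close>

lemma (in graph) nontrivial_component_iff:
  "(\<exists>C \<in> pre_digraph.sccs_verts (G \<restriction> (verts G - closed_nbhd G X)). card C \<ge> 2 \<and> v \<in> C)
    \<longleftrightarrow> v \<in> white G X"
proof -
  let ?U = "verts G - closed_nbhd G X"
  let ?H = "G \<restriction> ?U"
  interpret H: wf_digraph ?H by (rule wellformed_induce_subgraph)
  show ?thesis
  proof
    assume "\<exists>C \<in> pre_digraph.sccs_verts ?H. card C \<ge> 2 \<and> v \<in> C"
    then obtain C where C: "C \<in> pre_digraph.sccs_verts ?H" "card C \<ge> 2" "v \<in> C" by blast
    have "C \<noteq> {v}" using C(2) by auto
    then obtain w where w: "w \<in> C" "w \<noteq> v" using C(3) by blast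
    then have "v \<rightarrow>\<^sup>*\<^bsub>?H\<^esub> w" using C unfolding pre_digraph.sccs_verts_def by blast
    then obtain u where "v \<rightarrow>\<^bsub>?H\<^esub> u" using w(2) by (cases rule: pre_digraph.converse_reachable_cases) auto
    then show "v \<in> white G X" unfolding white_def by (auto simp: dominates_induce_iff)
  next
    assume "v \<in> white G X"
    then obtain u where u: "v \<in> ?U" "u \<in> ?U" "v \<rightarrow>\<^bsub>G\<^esub> u" unfolding white_def by blast
    then have "u \<rightarrow>\<^bsub>G\<^esub> v" using arcs_ends_symmetric[OF sym_arcs] by blast
    then have vu: "v \<rightarrow>\<^bsub>?H\<^esub> u" "u \<rightarrow>\<^bsub>?H\<^esub> v" using u by (auto simp: dominates_induce_iff)
    define C where "C = {w. v \<rightarrow>\<^sup>*\<^bsub>?H\<^esub> w \<and> w \<rightarrow>\<^sup>*\<^bsub>?H\<^esub> v}"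
    have "v \<rightarrow>\<^sup>*\<^bsub>?H\<^esub> v" using u(1) by (intro H.reachable_refl) simp
    then have vC: "v \<in> C" by (simp add: C_def)
    have "u \<in> C" using vu by (simp add: C_def H.reachable_adjI)
    have "C \<in> pre_digraph.sccs_verts ?H"
      unfolding pre_digraph.sccs_verts_def using vC
      by (auto simp: C_def intro: H.reachable_trans)
    moreover have "C \<subseteq> verts ?H" unfolding C_def using H.reachable_in_verts by blast
    \<comment> \<open>Needed because \<open>card\<close> of an infinite set is 0.\<close>
    then have "finite C" by (rule finite_subset) simp
    then have "card {u, v} \<le> card C" using vC \<open>u \<in> C\<close> by (intro card_mono) auto
    moreover have "u \<noteq> v" using u(3) adj_not_same by blast
    ultimately show "\<exists>C \<in> pre_digraph.sccs_verts ?H. card C \<ge> 2 \<and> v \<in> C"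
      using vC by (intro bexI[of _ C]) auto
  qed
qed

lemma (in graph) playable_iff:
  "x \<in> playable G X \<longleftrightarrow> x \<in> verts G \<and> (\<exists>v\<in>white G X. x = v \<or> x \<rightarrow>\<^bsub>G\<^esub> v)"
proof -
  have "x \<in> playable G X \<longleftrightarrow> x \<in> verts G \<and> (\<exists>v. v \<in> closed_nbhd G {x} \<and>
      (\<exists>C \<in> pre_digraph.sccs_verts (G \<restriction> (verts G - closed_nbhd G X)). card C \<ge> 2 \<and> v \<in> C))"
    unfolding playable_def by blast
  also have "\<dots> \<longleftrightarrow> x \<in> verts G \<and> (\<exists>v\<in>white G X. x = v \<or> x \<rightarrow>\<^bsub>G\<^esub> v)"
    unfolding nontrivial_component_iff by (auto simp: closed_nbhd_def white_def)
  finally show ?thesis .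
qed

section \<open>The bound by induction on the total weight\<close>

theorem theorem4p3:
  fixes T :: "('a, 'b) pre_digraph"
  assumes "undirected_tree T"
    and "card (verts T) \<ge> 3"
  shows "real (game_isolation_number T) \<le> 5 / 11 * real (card (verts T))"
proof -
  interpret graph T using assms(1) by (simp add: undirected_tree_def)
  interpret A: acyclic_simple_graph "verts T" "\<lambda>u v. u \<rightarrow>\<^bsub>T\<^esub> v"
    using assms by (rule undirected_tree_acyclic_simple_graph)
  have legal: "x \<in> playable T X \<longleftrightarrow> A.legal (white T X) x" for x X
    unfolding playable_iff A.legal_def A.nb_def by blast
  have fin: "finite (playable T X)" for X
    by (rule finite_subset[of _ "verts T"]) (auto simp: playable_iff)
  have pos: "A.position (white T X)" for X
    unfolding A.position_def A.nb_def white_def using A.adj_sym by blast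
  \<comment> \<open>The new white set depends only on the old one and the move, so the selected set
    can be forgotten.\<close>
  have step: "white T (insert x X) = A.step (white T X) x" if "x \<in> verts T" for x X
    unfolding white_def A.step_def closed_nbhd_def using A.adj_sym by blast
  \<comment> \<open>Each round of two moves consumes at least 22, that is, 11 per move.\<close>
  have main: "11 * moves_left T Dominator X \<le> A.\<Phi> (white T X)" for X
  proof (induction "A.\<Phi> (white T X)" arbitrary: X rule: less_induct)
    case less
    show ?case
    proof (cases "playable T X = {}")
      case True
      then show ?thesis by (simp add: moves_left.simps)
    next
      case False
      then have "white T X \<noteq> {}" by (auto simp: playable_iff)
      then obtain x where x: "A.legal (white T X) x"
        and d11: "A.\<Phi> (A.step (white T X) x) + 11 \<le> A.\<Phi> (white T X)"
        and d22: "\<And>y. A.legal (A.step (white T X) x) y \<Longrightarrow>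
          A.\<Phi> (A.step (A.step (white T X) x) y) + 22 \<le> A.\<Phi> (white T X)"
        using A.good_move[OF pos] by blast
      let ?Y = "insert x X"
      have xp: "x \<in> playable T X" using x legal by blast
      then have wY: "white T ?Y = A.step (white T X) x" by (intro step) (simp add: playable_iff)
      \<comment> \<open>Dominator's optimum is bounded by the chosen move \<open>x\<close>;
        Staller's optimum is attained at some reply, to which the bound for all replies
        applies.\<close>
      have "Min ((\<lambda>x. moves_left T Staller (insert x X)) ` playable T X) \<le> moves_left T Staller ?Y"
        using xp fin by (intro Min_le) auto
      then have D: "moves_left T Dominator X \<le> 1 + moves_left T Staller ?Y"
        using False by (simp add: moves_left.simps(1)[of T X])
      show ?thesis
      proof (cases "playable T ?Y = {}")
        case True
        then show ?thesis using D d11 by (simp add: moves_left.simps)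
      next
        case nonempty: False
        have "Max ((\<lambda>y. moves_left T Dominator (insert y ?Y)) ` playable T ?Y)
            \<in> (\<lambda>y. moves_left T Dominator (insert y ?Y)) ` playable T ?Y"
          using nonempty fin by (intro Max_in) auto
        then obtain y where y: "y \<in> playable T ?Y"
          "moves_left T Staller ?Y = 1 + moves_left T Dominator (insert y ?Y)"
          using nonempty by (auto simp: moves_left.simps(2)[of T ?Y])
        have wZ: "white T (insert y ?Y) = A.step (white T ?Y) y"
          using y(1) by (intro step) (simp add: playable_iff)
        have drop: "A.\<Phi> (white T (insert y ?Y)) + 22 \<le> A.\<Phi> (white T X)"
          using d22[of y] y(1) legal wY wZ by simp
        then have "11 * moves_left T Dominator (insert y ?Y) \<le> A.\<Phi> (white T (insert y ?Y))"
          by (intro less) simp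
        then show ?thesis using D y(2) drop by simp
      qed
    qed
  qed
  have "A.\<Phi> (white T {}) \<le> card (verts T) * 5"
    unfolding A.\<Phi>_def by (intro sum_bounded_above[where K = "5::nat", simplified]) (simp add: A.wt_def)
  then have "11 * game_isolation_number T \<le> 5 * card (verts T)"
    using main[of "{}"] by (simp add: game_isolation_number_def)
  then have "11 * real (game_isolation_number T) \<le> 5 * real (card (verts T))"
    by (metis of_nat_le_iff of_nat_mult of_nat_numeral)
  then show ?thesis by simp
qed

end
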